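(* Let $\mathcal X,\mathcal Y,\mathcal D$ be sets and let $G:\mathcal X\times\mathcal D\to[0,1]$ be a fuzzy relation. Let $X$ be any (a priori) fuzzy distribution on $\mathcal X$, let $\alpha$ be any fuzzy transition distribution from $\mathcal X$ to $\mathcal Y$, and let $\beta$ be a variant of the conditional distribution for $\alpha*X$ with respect to $\mathcal Y$. Let $Y$ be the $\mathcal Y$-marginal distribution of $\alpha*X$. Assume that for every $y\in\mathcal Y$ there exists a Bayes decision $d_{\beta(y)}\in\mathcal D$ with respect to the distribution $\beta(y)$, i.e. an element at which $d\mapsto G_{\beta(y)}(d)$ attains its maximum over $\mathcal D$. Then the decision strategy $r_X:\mathcal Y\to\mathcal D$ given by $r_X(y)=d_{\beta(y)}$ is optimal, i.e. $H_X(r)\le H_X(r_X)$ for every $r:\mathcal Y\to\mathcal D$, and its goodness is $$H_X(r_X)=\inf_{y\in\mathcal Y}\max\bigl(1-Y(y),\,G_{\beta(y)}(d_{\beta(y)})\bigr).$$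
   Context: A fuzzy distribution on a set $\mathcal X$ is any function $X:\mathcal X\to[0,1]$ (no normalization is required). Suprema and infima are taken in the complete lattice $[0,1]$. Fuzzy logic: conjunction is $\min$, disjunction is $\max$, negation is $a\mapsto 1-a$, implication $a\Rightarrow b$ is $\max(1-a,b)$, the universal quantifier is $\inf$, the existential one is $\sup$; the bounded universal quantifier "for all $x$ in $A$, $\varphi(x)$" has truth value $\inf_x\max(1-A(x),\varphi(x))$. A fuzzy transition distribution $\alpha$ from $\mathcal X$ to $\mathcal Y$ assigns to each $x\in\mathcal X$ a fuzzy distribution $\alpha(x):\mathcal Y\to[0,1]$. The joint distribution generated by $\alpha$ and $X$ is $(\alpha*X)(x,y)=\min(X(x),\alpha(x)(y))$ on $\mathcal X\times\mathcal Y$. For a joint distribution $A$ on $\mathcal X\times\mathcal Y$ the $\mathcal Y$-marginal is $Y(y)=\sup_x A(x,y)$, and a transition distribution $\beta$ from $\mathcal Y$ to $\mathcal X$ is (a variant of) the conditional distribution for $A$ with respect to $\mathcal Y$ if $A(x,y)=\min(Y(y),\beta(y)(x))$ for all $x,y$. $G(x,d)$ is the degree to which $d$ is a good decision for $x$. For a fuzzy distribution $X$ on $\mathcal X$, $G_X(d)=\inf_x\max(1-X(x),G(x,d))$. A decision strategy is a map $r:\mathcal Y\to\mathcal D$. Its goodness for $x$ is $H(x,r)=\inf_y\max(1-\alpha(x)(y),\,G(x,r(y)))$, and its Bayes goodness with respect to $X$ is $H_X(r)=\inf_x\max(1-X(x),H(x,r))$. *)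

theory Defs
  imports Complex_Main "HOL-Library.FuncSet"
begin

text \<open>
  Truth values are the reals in \<open>{0..1}\<close>, and the underlying sets are explicit carriers, which may
  be empty. In the complete lattice \<open>{0..1}\<close> the empty infimum is 1 and the empty supremum is 0,
  whereas \<^const>\<open>Inf\<close> and \<^const>\<open>Sup\<close> on type \<^typ>\<open>real\<close> are unspecified on the empty set. Inserting
  the bound changes nothing on nonempty subsets of \<open>{0..1}\<close> and gives the right value on the empty
  one.
\<close>

definition finf :: "'a set \<Rightarrow> ('a \<Rightarrow> real) \<Rightarrow> real" where
  "finf A f = Inf (insert 1 (f ` A))"

definition fsup :: "'a set \<Rightarrow> ('a \<Rightarrow> real) \<Rightarrow> real" where
  "fsup A f = Sup (insert 0 (f ` A))"

definition fuzzy_dist :: "'a set \<Rightarrow> ('a \<Rightarrow> real) \<Rightarrow> bool" where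
  "fuzzy_dist A P \<longleftrightarrow> (\<forall>a\<in>A. P a \<in> {0..1})"

lemma finf_in_unit: "fuzzy_dist A f \<Longrightarrow> finf A f \<in> {0..1}"
  unfolding finf_def fuzzy_dist_def
  by (auto intro!: cInf_greatest cInf_lower bdd_belowI[of _ 0])

lemma finf_greatest_iff:
  assumes "fuzzy_dist A f" "c \<in> {0..1}"
  shows "c \<le> finf A f \<longleftrightarrow> (\<forall>a\<in>A. c \<le> f a)"
proof -
  have "bdd_below (insert 1 (f ` A))"
    using assms(1) by (auto simp: fuzzy_dist_def intro!: bdd_belowI[of _ 0])
  then show ?thesis
    using assms(2) by (simp add: finf_def le_cInf_iff)
qed

lemma fsup_in_unit: "fuzzy_dist A f \<Longrightarrow> fsup A f \<in> {0..1}"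
  unfolding fsup_def fuzzy_dist_def
  by (auto intro!: cSup_least cSup_upper bdd_aboveI[of _ 1])

lemma fsup_least_iff:
  assumes "fuzzy_dist A f" "c \<in> {0..1}"
  shows "fsup A f \<le> c \<longleftrightarrow> (\<forall>a\<in>A. f a \<le> c)"
proof -
  have "bdd_above (insert 0 (f ` A))"
    using assms(1) by (auto simp: fuzzy_dist_def intro!: bdd_aboveI[of _ 1])
  then show ?thesis
    using assms(2) by (simp add: fsup_def cSup_le_iff)
qed

definition fuzzy_transition :: "'a set \<Rightarrow> 'b set \<Rightarrow> ('a \<Rightarrow> 'b \<Rightarrow> real) \<Rightarrow> bool" where
  "fuzzy_transition A B \<alpha> \<longleftrightarrow> (\<forall>a\<in>A. fuzzy_dist B (\<alpha> a))"

definition joint :: "('x \<Rightarrow> 'y \<Rightarrow> real) \<Rightarrow> ('x \<Rightarrow> real) \<Rightarrow> 'x \<times> 'y \<Rightarrow> real" where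
  "joint \<alpha> P = (\<lambda>(x, y). min (P x) (\<alpha> x y))"

definition marginal_snd :: "'x set \<Rightarrow> ('x \<times> 'y \<Rightarrow> real) \<Rightarrow> 'y \<Rightarrow> real" where
  "marginal_snd \<X> A y = fsup \<X> (\<lambda>x. A (x, y))"

definition conditional_variant ::
  "'x set \<Rightarrow> 'y set \<Rightarrow> ('x \<times> 'y \<Rightarrow> real) \<Rightarrow> ('y \<Rightarrow> 'x \<Rightarrow> real) \<Rightarrow> bool" where
  "conditional_variant \<X> \<Y> A \<beta> \<longleftrightarrow>
     fuzzy_transition \<Y> \<X> \<beta> \<and>
     (\<forall>x\<in>\<X>. \<forall>y\<in>\<Y>. A (x, y) = min (marginal_snd \<X> A y) (\<beta> y x))"

text \<open>The truth value of ``for all \<open>x\<close> in the fuzzy set \<open>P\<close>, \<open>\<phi> x\<close>''.\<close>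

definition fuzzy_ball :: "'a set \<Rightarrow> ('a \<Rightarrow> real) \<Rightarrow> ('a \<Rightarrow> real) \<Rightarrow> real" where
  "fuzzy_ball A P \<phi> = finf A (\<lambda>x. max (1 - P x) (\<phi> x))"

text \<open>The quantities \<open>G\<^sub>P(d)\<close>, \<open>H(x, r)\<close> and \<open>H\<^sub>P(r)\<close>.\<close>

definition decision_goodness ::
  "'x set \<Rightarrow> ('x \<times> 'd \<Rightarrow> real) \<Rightarrow> ('x \<Rightarrow> real) \<Rightarrow> 'd \<Rightarrow> real" where
  "decision_goodness \<X> G P d = fuzzy_ball \<X> P (\<lambda>x. G (x, d))"

definition strategy_goodness ::
  "'y set \<Rightarrow> ('x \<times> 'd \<Rightarrow> real) \<Rightarrow> ('x \<Rightarrow> 'y \<Rightarrow> real) \<Rightarrow> 'x \<Rightarrow> ('y \<Rightarrow> 'd) \<Rightarrow> real" where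
  "strategy_goodness \<Y> G \<alpha> x r = fuzzy_ball \<Y> (\<alpha> x) (\<lambda>y. G (x, r y))"

definition bayes_goodness ::
  "'x set \<Rightarrow> 'y set \<Rightarrow> ('x \<times> 'd \<Rightarrow> real) \<Rightarrow> ('x \<Rightarrow> 'y \<Rightarrow> real) \<Rightarrow> ('x \<Rightarrow> real) \<Rightarrow> ('y \<Rightarrow> 'd) \<Rightarrow> real" where
  "bayes_goodness \<X> \<Y> G \<alpha> P r = fuzzy_ball \<X> P (\<lambda>x. strategy_goodness \<Y> G \<alpha> x r)"

definition bayes_decision ::
  "'x set \<Rightarrow> 'd set \<Rightarrow> ('x \<times> 'd \<Rightarrow> real) \<Rightarrow> ('x \<Rightarrow> real) \<Rightarrow> 'd \<Rightarrow> bool" where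
  "bayes_decision \<X> \<D> G P d \<longleftrightarrow>
     d \<in> \<D> \<and> (\<forall>d'\<in>\<D>. decision_goodness \<X> G P d' \<le> decision_goodness \<X> G P d)"

definition optimal_strategy ::
  "'x set \<Rightarrow> 'y set \<Rightarrow> 'd set \<Rightarrow> ('x \<times> 'd \<Rightarrow> real) \<Rightarrow> ('x \<Rightarrow> 'y \<Rightarrow> real) \<Rightarrow> ('x \<Rightarrow> real)
     \<Rightarrow> ('y \<Rightarrow> 'd) \<Rightarrow> bool" where
  "optimal_strategy \<X> \<Y> \<D> G \<alpha> P r \<longleftrightarrow>
     r \<in> \<Y> \<rightarrow> \<D> \<and>
     (\<forall>r'\<in>\<Y> \<rightarrow> \<D>. bayes_goodness \<X> \<Y> G \<alpha> P r' \<le> bayes_goodness \<X> \<Y> G \<alpha> P r)"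

end

theory Submission
  imports Defs
begin

text \<open>
  A guard by \<open>P x\<close> followed by a guard by \<open>Q x y\<close> is one guard by \<open>min (P x) (Q x y)\<close>, so a nested
  bounded quantifier depends only on the joint distribution of its guards. As \<open>\<beta>\<close> generates the same
  joint distribution from \<open>Y\<close> as \<open>\<alpha>\<close> does from \<open>X\<close>, the quantifiers over \<open>x\<close> and \<open>y\<close> may be
  exchanged: the Bayes goodness of any strategy \<open>r\<close> is the infimum over \<open>y\<close> of
  \<open>max (1 - Y y) (G\<^bsub>\<beta> y\<^esub> (r y))\<close>. This can be maximized separately for each \<open>y\<close>.
\<close>

lemma fuzzy_dist_fuzzy_ball_body:
  assumes "fuzzy_dist A P" "fuzzy_dist A \<phi>"
  shows "fuzzy_dist A (\<lambda>x. max (1 - P x) (\<phi> x))"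
  using assms by (auto simp: fuzzy_dist_def max_def)

lemma fuzzy_ball_in_unit:
  assumes "fuzzy_dist A P" "fuzzy_dist A \<phi>"
  shows "fuzzy_ball A P \<phi> \<in> {0..1}"
  unfolding fuzzy_ball_def by (intro finf_in_unit fuzzy_dist_fuzzy_ball_body assms)

text \<open>Trades an infimum for pointwise inequalities, the form in which the comparisons below
  are made. That \<open>c\<close> is at most 1 matters when \<open>A\<close> is empty: the infimum
  is then 1.\<close>

lemma le_fuzzy_ball_iff:
  assumes "fuzzy_dist A P" "fuzzy_dist A \<phi>" "c \<in> {0..1}"
  shows "c \<le> fuzzy_ball A P \<phi> \<longleftrightarrow> (\<forall>x\<in>A. c \<le> max (1 - P x) (\<phi> x))"
  unfolding fuzzy_ball_def by (intro finf_greatest_iff fuzzy_dist_fuzzy_ball_body assms)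

lemma fuzzy_ball_mono:
  assumes "fuzzy_dist A P" "fuzzy_dist A \<phi>" "fuzzy_dist A \<psi>"
    and "\<And>x. x \<in> A \<Longrightarrow> \<phi> x \<le> \<psi> x"
  shows "fuzzy_ball A P \<phi> \<le> fuzzy_ball A P \<psi>"
proof -
  \<comment> \<open>The smaller infimum itself serves as the bound: it lies below every term for
    \<open>\<phi>\<close>, hence below every term for \<open>\<psi>\<close>.\<close>
  let ?c = "fuzzy_ball A P \<phi>"
  have c: "?c \<in> {0..1}"
    using assms by (intro fuzzy_ball_in_unit)
  then have "\<forall>x\<in>A. ?c \<le> max (1 - P x) (\<phi> x)"
    using le_fuzzy_ball_iff[OF assms(1,2) c] by simp
  then have "\<forall>x\<in>A. ?c \<le> max (1 - P x) (\<psi> x)"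
    using assms(4) by (meson max.mono order_refl order_trans)
  then show ?thesis
    using le_fuzzy_ball_iff[OF assms(1,3) c] by simp
qed

lemma fuzzy_dist_fuzzy_ball:
  assumes "\<forall>x\<in>A. fuzzy_dist B (Q x)" "\<forall>x\<in>A. fuzzy_dist B (\<phi> x)"
  shows "fuzzy_dist A (\<lambda>x. fuzzy_ball B (Q x) (\<phi> x))"
  using assms fuzzy_ball_in_unit unfolding fuzzy_dist_def[of A] by blast

text \<open>Rests on \<open>1 - min a b = max (1 - a) (1 - b)\<close>: lying below a maximum means
  lying below one of its terms, so the two guards become alternatives under one pair of
  quantifiers.\<close>

lemma le_fuzzy_ball_fuzzy_ball_iff:
  assumes "fuzzy_dist A P" "\<forall>x\<in>A. fuzzy_dist B (Q x)" "\<forall>x\<in>A. fuzzy_dist B (\<phi> x)" "c \<in> {0..1}"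
  shows "c \<le> fuzzy_ball A P (\<lambda>x. fuzzy_ball B (Q x) (\<phi> x)) \<longleftrightarrow>
    (\<forall>x\<in>A. \<forall>y\<in>B. c \<le> max (1 - min (P x) (Q x y)) (\<phi> x y))"
proof -
  have "c \<le> fuzzy_ball A P (\<lambda>x. fuzzy_ball B (Q x) (\<phi> x)) \<longleftrightarrow>
      (\<forall>x\<in>A. c \<le> 1 - P x \<or> c \<le> fuzzy_ball B (Q x) (\<phi> x))"
    using assms by (simp add: le_fuzzy_ball_iff fuzzy_dist_fuzzy_ball le_max_iff_disj)
  also have "\<dots> \<longleftrightarrow> (\<forall>x\<in>A. c \<le> 1 - P x \<or> (\<forall>y\<in>B. c \<le> max (1 - Q x y) (\<phi> x y)))"
    using assms by (simp add: le_fuzzy_ball_iff)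
  \<comment> \<open>The alternative \<open>c \<le> 1 - P x\<close> does not depend on
    \<open>y\<close>, so it passes under the quantifier over \<open>y\<close>, even when
    \<open>B\<close> is empty.\<close>
  also have "\<dots> \<longleftrightarrow> (\<forall>x\<in>A. \<forall>y\<in>B. c \<le> 1 - P x \<or> c \<le> max (1 - Q x y) (\<phi> x y))"
    by blast
  also have "\<dots> \<longleftrightarrow> (\<forall>x\<in>A. \<forall>y\<in>B. c \<le> max (1 - min (P x) (Q x y)) (\<phi> x y))"
    by (intro ball_cong refl) (auto simp: max_def min_def)
  finally show ?thesis .
qed

lemma fuzzy_ball_swap:
  assumes P: "fuzzy_dist A P" and Q: "\<forall>x\<in>A. fuzzy_dist B (Q x)"
    and R: "fuzzy_dist B R" and S: "\<forall>y\<in>B. fuzzy_dist A (S y)"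
    and \<phi>: "\<And>x y. x \<in> A \<Longrightarrow> y \<in> B \<Longrightarrow> \<phi> x y \<in> {0..1}"
    and joint: "\<And>x y. x \<in> A \<Longrightarrow> y \<in> B \<Longrightarrow> min (P x) (Q x y) = min (R y) (S y x)"
  shows "fuzzy_ball A P (\<lambda>x. fuzzy_ball B (Q x) (\<phi> x)) =
    fuzzy_ball B R (\<lambda>y. fuzzy_ball A (S y) (\<lambda>x. \<phi> x y))" (is "?l = ?r")
proof -
  have \<phi>1: "\<forall>x\<in>A. fuzzy_dist B (\<phi> x)" and \<phi>2: "\<forall>y\<in>B. fuzzy_dist A (\<lambda>x. \<phi> x y)"
    using \<phi> by (auto simp: fuzzy_dist_def)
  \<comment> \<open>By \<open>joint\<close>, the two families of inequalities differ only in the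
    order of the universal quantifiers.\<close>
  have "c \<le> ?l \<longleftrightarrow> c \<le> ?r" if "c \<in> {0..1}" for c
    unfolding le_fuzzy_ball_fuzzy_ball_iff[OF P Q \<phi>1 that]
      le_fuzzy_ball_fuzzy_ball_iff[OF R S \<phi>2 that]
    using joint by fastforce
  moreover have "?l \<in> {0..1}" "?r \<in> {0..1}"
    using P Q R S \<phi>1 \<phi>2 by (simp_all add: fuzzy_ball_in_unit fuzzy_dist_fuzzy_ball del: atLeastAtMost_iff)
  \<comment> \<open>Taking \<open>c\<close> to be \<open>?l\<close> and then \<open>?r\<close> gives
    the two inequalities.\<close>
  ultimately show ?thesis
    by (intro antisym) blast+
qed

lemma fuzzy_dist_marginal_snd_joint:
  assumes "fuzzy_dist \<X> X" "fuzzy_transition \<X> \<Y> \<alpha>"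
  shows "fuzzy_dist \<Y> (marginal_snd \<X> (joint \<alpha> X))"
  unfolding fuzzy_dist_def[of \<Y>] marginal_snd_def
  using assms by (intro ballI fsup_in_unit)
    (auto simp: joint_def fuzzy_dist_def fuzzy_transition_def min_def)

text \<open>A strategy sees only \<open>y\<close>. Once \<open>y\<close> is the outer variable,
  \<open>r y\<close> is fixed while \<open>x\<close> varies, so the inner quantifier measures a
  single decision against \<open>\<beta> y\<close>.\<close>

lemma bayes_goodness_eq:
  assumes G: "fuzzy_dist (\<X> \<times> \<D>) G" and X: "fuzzy_dist \<X> X"
    and \<alpha>: "fuzzy_transition \<X> \<Y> \<alpha>"
    and \<beta>: "conditional_variant \<X> \<Y> (joint \<alpha> X) \<beta>"
    and r: "r \<in> \<Y> \<rightarrow> \<D>"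
  shows "bayes_goodness \<X> \<Y> G \<alpha> X r =
    fuzzy_ball \<Y> (marginal_snd \<X> (joint \<alpha> X)) (\<lambda>y. decision_goodness \<X> G (\<beta> y) (r y))"
  unfolding bayes_goodness_def strategy_goodness_def decision_goodness_def
proof (rule fuzzy_ball_swap[OF X])
  show "\<forall>x\<in>\<X>. fuzzy_dist \<Y> (\<alpha> x)"
    using \<alpha> by (simp add: fuzzy_transition_def)
  show "fuzzy_dist \<Y> (marginal_snd \<X> (joint \<alpha> X))"
    using X \<alpha> by (rule fuzzy_dist_marginal_snd_joint)
  show "\<forall>y\<in>\<Y>. fuzzy_dist \<X> (\<beta> y)"
    using \<beta> by (simp add: conditional_variant_def fuzzy_transition_def)
  show "G (x, r y) \<in> {0..1}" if "x \<in> \<X>" "y \<in> \<Y>" for x y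
    using G r that by (auto simp: fuzzy_dist_def Pi_iff)
  \<comment> \<open>This is the defining equation of the conditional distribution, with
    \<open>joint\<close> unfolded.\<close>
  show "min (X x) (\<alpha> x y) = min (marginal_snd \<X> (joint \<alpha> X) y) (\<beta> y x)"
    if "x \<in> \<X>" "y \<in> \<Y>" for x y
    using \<beta> that by (simp add: conditional_variant_def joint_def)
qed

theorem theorem6p1:
  fixes \<X> :: "'x set" and \<Y> :: "'y set" and \<D> :: "'d set"
    and G :: "'x \<times> 'd \<Rightarrow> real"
    and X :: "'x \<Rightarrow> real" and Y :: "'y \<Rightarrow> real"
    and \<alpha> :: "'x \<Rightarrow> 'y \<Rightarrow> real" and \<beta> :: "'y \<Rightarrow> 'x \<Rightarrow> real"
    and d :: "'y \<Rightarrow> 'd" and r\<^sub>X :: "'y \<Rightarrow> 'd"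
  assumes "fuzzy_dist (\<X> \<times> \<D>) G"
    and "fuzzy_dist \<X> X"
    and "fuzzy_transition \<X> \<Y> \<alpha>"
    and "conditional_variant \<X> \<Y> (joint \<alpha> X) \<beta>"
    and "\<And>y. y \<in> \<Y> \<Longrightarrow> Y y = marginal_snd \<X> (joint \<alpha> X) y"
    and "\<And>y. y \<in> \<Y> \<Longrightarrow> bayes_decision \<X> \<D> G (\<beta> y) (d y)"
    and "\<And>y. y \<in> \<Y> \<Longrightarrow> r\<^sub>X y = d y"
  shows "optimal_strategy \<X> \<Y> \<D> G \<alpha> X r\<^sub>X \<and>
    bayes_goodness \<X> \<Y> G \<alpha> X r\<^sub>X =
      finf \<Y> (\<lambda>y. max (1 - Y y) (decision_goodness \<X> G (\<beta> y) (d y)))"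
proof -
  note X = assms(2) and \<alpha> = assms(3) and \<beta> = assms(4)
  let ?M = "marginal_snd \<X> (joint \<alpha> X)"
  note goodness = bayes_goodness_eq[OF assms(1-4)]
  have r\<^sub>X: "r\<^sub>X \<in> \<Y> \<rightarrow> \<D>"
    using assms(6,7) by (auto simp: bayes_decision_def)
  have M: "fuzzy_dist \<Y> ?M"
    using X \<alpha> by (rule fuzzy_dist_marginal_snd_joint)
  have dist: "fuzzy_dist \<Y> (\<lambda>y. decision_goodness \<X> G (\<beta> y) (r y))" if "r \<in> \<Y> \<rightarrow> \<D>" for r
    unfolding decision_goodness_def
    using \<beta> assms(1) that
    by (intro fuzzy_dist_fuzzy_ball)
      (auto simp: conditional_variant_def fuzzy_transition_def fuzzy_dist_def Pi_iff)
  \<comment> \<open>The weights \<open>?M y\<close> are the same for both strategies, and at each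
    \<open>y\<close> the Bayes decision is at least as good for \<open>\<beta> y\<close> as
    \<open>r y\<close>, so monotonicity suffices.\<close>
  have "bayes_goodness \<X> \<Y> G \<alpha> X r \<le> bayes_goodness \<X> \<Y> G \<alpha> X r\<^sub>X" if r: "r \<in> \<Y> \<rightarrow> \<D>" for r
    unfolding goodness[OF r] goodness[OF r\<^sub>X]
    using assms(6,7) r
    by (intro fuzzy_ball_mono M dist r\<^sub>X) (auto simp: bayes_decision_def Pi_iff)
  \<comment> \<open>\<open>Y\<close> agrees with \<open>?M\<close>, and \<open>r\<^sub>X\<close>
    with \<open>d\<close>, by assumption only on \<open>\<Y>\<close>, which is enough since the
    infimum ranges over the image of \<open>\<Y>\<close>.\<close>
  moreover have "bayes_goodness \<X> \<Y> G \<alpha> X r\<^sub>X =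
      finf \<Y> (\<lambda>y. max (1 - Y y) (decision_goodness \<X> G (\<beta> y) (d y)))"
    unfolding goodness[OF r\<^sub>X] fuzzy_ball_def finf_def
    using assms(5,7) by (simp cong: image_cong)
  ultimately show ?thesis
    using r\<^sub>X by (auto simp: optimal_strategy_def)
qed

end
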